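(* Let $I_1$ and $I_2$ be non-trivial admissible ideals on $\mathbb{N}$ such that $I_1\subset I_2$, let $D\subset\mathbb{R}$, let $f:D\to\mathbb{R}$, and let $x\in D$. Then $f$ is rough $(I_1,I_2)$-continuous at $x$ if and only if $f$ is rough $I_{fin}$-continuous at $x$, where $I_{fin}$ is the ideal of all finite subsets of $\mathbb{N}$.
   Context: An ideal on $\mathbb{N}$ is a collection $I$ of subsets of $\mathbb{N}$ such that $A,B\in I$ implies $A\cup B\in I$, and $A\in I$, $B\subset A$ implies $B\in I$. It is non-trivial if $I\ne\emptyset$ and $\mathbb{N}\notin I$, and admissible if $\{n\}\in I$ for every $n\in\mathbb{N}$. Let $I$ be an ideal on $\mathbb{N}$, $\{y_n\}_{n\in\mathbb{N}}$ a real sequence, $y\in\mathbb{R}$ and $r\ge 0$ a real number. The sequence is rough $I$-convergent of roughness degree $r$ to $y$ if $\{n\in\mathbb{N}:|y_n-y|\ge r+\varepsilon\}\in I$ for every $\varepsilon>0$. It is $I$-convergent to $y$ if it is rough $I$-convergent of roughness degree $0$ to $y$. A function $f:D\to\mathbb{R}$ is rough $(I_1,I_2)$-continuous at $x\in D$ if there is a real number $r\ge 0$ such that for every sequence $\{x_n\}\subset D$ that is $I_1$-convergent to $x$, $\{f(x_n)\}$ is rough $I_2$-convergent of roughness degree $r$ to $f(x)$. It is rough $I$-continuous at $x$ if it is rough $(I,I)$-continuous at $x$. *)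

theory Defs
  imports Complex_Main
begin

text \<open>As in the source, the empty collection counts as an ideal; it is excluded by
  non-triviality.\<close>

definition ideal_on_nat :: "nat set set \<Rightarrow> bool" where
  "ideal_on_nat I \<longleftrightarrow>
     (\<forall>A B. A \<in> I \<longrightarrow> B \<in> I \<longrightarrow> A \<union> B \<in> I) \<and>
     (\<forall>A B. A \<in> I \<longrightarrow> B \<subseteq> A \<longrightarrow> B \<in> I)"

definition nontrivial_ideal :: "nat set set \<Rightarrow> bool" where
  "nontrivial_ideal I \<longleftrightarrow> ideal_on_nat I \<and> I \<noteq> {} \<and> UNIV \<notin> I"

definition admissible_ideal :: "nat set set \<Rightarrow> bool" where
  "admissible_ideal I \<longleftrightarrow> ideal_on_nat I \<and> (\<forall>n. {n} \<in> I)"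

definition I_fin :: "nat set set" where
  "I_fin = {A. finite A}"

text \<open>The roughness degree \<open>r\<close> is meant to be nonnegative; this is required where degrees
  are quantified, in the definition of rough continuity.\<close>

definition rough_ideal_convergent ::
    "nat set set \<Rightarrow> real \<Rightarrow> (nat \<Rightarrow> real) \<Rightarrow> real \<Rightarrow> bool" where
  "rough_ideal_convergent I r y l \<longleftrightarrow>
     (\<forall>\<epsilon>>0. {n. \<bar>y n - l\<bar> \<ge> r + \<epsilon>} \<in> I)"

definition ideal_convergent :: "nat set set \<Rightarrow> (nat \<Rightarrow> real) \<Rightarrow> real \<Rightarrow> bool" where
  "ideal_convergent I y l \<longleftrightarrow> rough_ideal_convergent I 0 y l"

text \<open>A function \<open>D \<rightarrow> \<real>\<close> is represented by a total function \<open>f\<close> of which only the values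
  on \<open>D\<close> matter; the point \<open>x\<close> is meant to lie in \<open>D\<close>.\<close>

definition rough_continuous2_at ::
    "nat set set \<Rightarrow> nat set set \<Rightarrow> real set \<Rightarrow> (real \<Rightarrow> real) \<Rightarrow> real \<Rightarrow> bool" where
  "rough_continuous2_at I1 I2 D f x \<longleftrightarrow>
     (\<exists>r\<ge>0. \<forall>u :: nat \<Rightarrow> real.
        (\<forall>n. u n \<in> D) \<longrightarrow> ideal_convergent I1 u x \<longrightarrow>
        rough_ideal_convergent I2 r (\<lambda>n. f (u n)) (f x))"

definition rough_continuous_at ::
    "nat set set \<Rightarrow> real set \<Rightarrow> (real \<Rightarrow> real) \<Rightarrow> real \<Rightarrow> bool" where
  "rough_continuous_at I D f x \<longleftrightarrow> rough_continuous2_at I I D f x"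

end

theory Submission
  imports Defs
begin

text \<open>For a fixed degree \<open>r\<close>, the sequential condition is equivalent to an
  \<open>\<epsilon>\<close>-\<open>\<delta>\<close> condition that mentions no ideal, so it is the same for every pair of ideals,
  in particular for \<open>(I_fin, I_fin)\<close>.\<close>

lemma admissible_ideal_finite:
  assumes "admissible_ideal I" and "finite A"
  shows "A \<in> I"
  using assms(2)
proof (induction A rule: finite_induct)
  case empty
  \<comment> \<open>The ideal axioms alone do not put the empty set into \<open>I\<close>; it enters
    as a subset of a singleton supplied by admissibility.\<close>
  have "{0} \<in> I"
    using assms(1) by (auto simp: admissible_ideal_def)
  then show ?case
    using assms(1) unfolding admissible_ideal_def ideal_on_nat_def by blast
next
  case (insert a A)
  have "{a} \<in> I"
    using assms(1) by (auto simp: admissible_ideal_def)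
  then have "{a} \<union> A \<in> I"
    using assms(1) insert.IH unfolding admissible_ideal_def ideal_on_nat_def by blast
  then show ?case by simp
qed

lemma ideal_on_nat_I_fin: "ideal_on_nat I_fin"
  by (auto simp: ideal_on_nat_def I_fin_def intro: finite_subset)

lemma nontrivial_I_fin: "nontrivial_ideal I_fin"
  using ideal_on_nat_I_fin by (auto simp: nontrivial_ideal_def I_fin_def)

lemma admissible_I_fin: "admissible_ideal I_fin"
  using ideal_on_nat_I_fin by (auto simp: admissible_ideal_def I_fin_def)

text \<open>For each \<open>\<epsilon>\<close> ordinary convergence leaves only finitely many
  exceptional indices, and an admissible ideal contains every finite set.\<close>

lemma LIMSEQ_imp_ideal_convergent:
  assumes "admissible_ideal I" and "u \<longlonglongrightarrow> l"
  shows "ideal_convergent I u l"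
  unfolding ideal_convergent_def rough_ideal_convergent_def
proof (intro allI impI)
  fix \<epsilon> :: real
  assume "\<epsilon> > 0"
  then obtain N where "\<And>n. n \<ge> N \<Longrightarrow> \<bar>u n - l\<bar> < \<epsilon>"
    using LIMSEQ_D[OF assms(2)] by (metis real_norm_def)
  then have "{n. \<bar>u n - l\<bar> \<ge> 0 + \<epsilon>} \<subseteq> {..<N}"
    by (force simp: not_le[symmetric])
  then show "{n. \<bar>u n - l\<bar> \<ge> 0 + \<epsilon>} \<in> I"
    by (intro admissible_ideal_finite[OF assms(1)]) (rule finite_subset, auto)
qed

text \<open>From left to right, ordinary convergent sequences are available as test sequences
  because \<open>I1\<close> is admissible, and a sequence that is bad at every index contradicts
  \<open>UNIV \<notin> I2\<close>. From right to left, exceptional sets are carried from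
  \<open>I1\<close> to \<open>I2\<close> by inclusion and then shrunk by downward closure.\<close>

lemma rough_sequential_iff_eps_delta:
  assumes I1: "admissible_ideal I1" and I2: "nontrivial_ideal I2" and "I1 \<subseteq> I2"
  shows "(\<forall>u :: nat \<Rightarrow> real. (\<forall>n. u n \<in> D) \<longrightarrow> ideal_convergent I1 u x \<longrightarrow>
            rough_ideal_convergent I2 r (\<lambda>n. f (u n)) (f x)) \<longleftrightarrow>
         (\<forall>\<epsilon>>0. \<exists>\<delta>>0. \<forall>y\<in>D. \<bar>y - x\<bar> < \<delta> \<longrightarrow> \<bar>f y - f x\<bar> < r + \<epsilon>)"
    (is "?seq \<longleftrightarrow> ?eps")
proof
  assume seq: ?seq
  show ?eps
  proof (rule ccontr)
    assume "\<not> ?eps"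
    then obtain \<epsilon> where "\<epsilon> > 0"
      and bad: "\<And>\<delta>. \<delta> > 0 \<Longrightarrow> \<exists>y\<in>D. \<bar>y - x\<bar> < \<delta> \<and> \<bar>f y - f x\<bar> \<ge> r + \<epsilon>"
      by (meson not_less)
    \<comment> \<open>Taking \<open>\<delta> = 1/(n+1)\<close> makes the chosen points converge to
      \<open>x\<close> in the ordinary sense; \<open>Suc\<close> keeps the bound positive at
      \<open>n = 0\<close>.\<close>
    have "\<forall>n. \<exists>y. y \<in> D \<and> \<bar>y - x\<bar> < inverse (real (Suc n)) \<and> \<bar>f y - f x\<bar> \<ge> r + \<epsilon>"
      using bad by (metis inverse_positive_iff_positive of_nat_0_less_iff zero_less_Suc)
    then obtain u where uD: "\<And>n. u n \<in> D"
      and close: "\<And>n. \<bar>u n - x\<bar> < inverse (real (Suc n))"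
      and far: "\<And>n. \<bar>f (u n) - f x\<bar> \<ge> r + \<epsilon>"
      by metis
    have "(\<lambda>n. u n - x) \<longlonglongrightarrow> 0"
      by (rule tendsto_0_le[OF LIMSEQ_inverse_real_of_nat, where K = 1])
        (use close in \<open>auto intro!: always_eventually less_imp_le\<close>)
    then have "u \<longlonglongrightarrow> x"
      by (rule LIM_zero_cancel)
    then have "rough_ideal_convergent I2 r (\<lambda>n. f (u n)) (f x)"
      using seq uD LIMSEQ_imp_ideal_convergent[OF I1] by blast
    then have "{n. \<bar>f (u n) - f x\<bar> \<ge> r + \<epsilon>} \<in> I2"
      using \<open>\<epsilon> > 0\<close> by (simp add: rough_ideal_convergent_def)
    \<comment> \<open>By \<open>far\<close> every index is exceptional, so the set just placed in
      \<open>I2\<close> is \<open>UNIV\<close>.\<close>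
    then show False
      using far I2 by (simp add: nontrivial_ideal_def)
  qed
next
  assume eps: ?eps
  show ?seq
    unfolding rough_ideal_convergent_def
  proof (intro allI impI)
    fix u :: "nat \<Rightarrow> real" and \<epsilon> :: real
    assume uD: "\<forall>n. u n \<in> D" and conv: "ideal_convergent I1 u x" and "\<epsilon> > 0"
    then obtain \<delta> where "\<delta> > 0"
      and \<delta>: "\<And>y. y \<in> D \<Longrightarrow> \<bar>y - x\<bar> < \<delta> \<Longrightarrow> \<bar>f y - f x\<bar> < r + \<epsilon>"
      using eps by blast
    have "{n. \<bar>u n - x\<bar> \<ge> \<delta>} \<in> I2"
      using conv \<open>\<delta> > 0\<close> \<open>I1 \<subseteq> I2\<close>
      by (auto simp: ideal_convergent_def rough_ideal_convergent_def)
    \<comment> \<open>This is the contrapositive of \<open>\<delta>\<close> applied at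
      \<open>y = u n\<close>.\<close>
    moreover have "{n. \<bar>f (u n) - f x\<bar> \<ge> r + \<epsilon>} \<subseteq> {n. \<bar>u n - x\<bar> \<ge> \<delta>}"
      using \<delta> uD by (auto simp: not_less[symmetric])
    ultimately show "{n. \<bar>f (u n) - f x\<bar> \<ge> r + \<epsilon>} \<in> I2"
      using I2 unfolding nontrivial_ideal_def ideal_on_nat_def by blast
  qed
qed

theorem theorem4p2:
  fixes I1 I2 :: "nat set set" and D :: "real set" and f :: "real \<Rightarrow> real" and x :: real
  assumes "nontrivial_ideal I1" and "admissible_ideal I1"
    and "nontrivial_ideal I2" and "admissible_ideal I2"
    and "I1 \<subseteq> I2"
    and "x \<in> D"
  shows "rough_continuous2_at I1 I2 D f x \<longleftrightarrow> rough_continuous_at I_fin D f x"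
  \<comment> \<open>The rewriting takes place under the quantifier over \<open>r\<close>, so both
    sides become the same formula, with the same degree \<open>r\<close> as witness.\<close>
  unfolding rough_continuous_at_def rough_continuous2_at_def
    rough_sequential_iff_eps_delta[OF assms(2,3,5)]
    rough_sequential_iff_eps_delta[OF admissible_I_fin nontrivial_I_fin order_refl]
  by (rule refl)

end
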